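(* Let $\lambda$ be a non-zero cardinal. The semigroup $\mathfrak{End}^{\mathrm{inj}}(\mathscr{B}_{\lambda})$ of all injective endomorphisms of $\mathscr{B}_{\lambda}$ is isomorphic to the semigroup of all injective transformations of $\lambda$ (injective maps $\lambda\to\lambda$ under composition), and moreover the group $\mathfrak{Aut}(\mathscr{B}_{\lambda})$ of automorphisms of $\mathscr{B}_{\lambda}$ is isomorphic to the group of all bijective transformations of $\lambda$.
   Context: For a non-zero cardinal $\lambda$, the semigroup of $\lambda\times\lambda$-matrix units is the set $\mathscr{B}_{\lambda}=(\lambda\times\lambda)\cup\{\boldsymbol{0}\}$ (with $\boldsymbol{0}\notin\lambda\times\lambda$) with operation $(a,b)\cdot(c,d)=(a,d)$ if $b=c$ and $(a,b)\cdot(c,d)=\boldsymbol{0}$ otherwise, and $(a,b)\cdot\boldsymbol{0}=\boldsymbol{0}\cdot(a,b)=\boldsymbol{0}\cdot\boldsymbol{0}=\boldsymbol{0}$, for all $a,b,c,d\in\lambda$. An endomorphism of a semigroup is a homomorphism to itself; an automorphism is a bijective endomorphism. Maps are written on the right of their arguments and composed left to right, $(x)(f\circ g)=((x)f)g$, both for endomorphisms and for transformations of $\lambda$. *)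

theory Defs
  imports "HOL-Algebra.Bij"
begin

text \<open>
  A cardinal is represented by an arbitrary set \<open>L\<close> having that cardinality. The constructor
  \<open>None\<close> is the adjoined zero and \<open>Some (a, b)\<close> is the matrix unit \<open>(a, b)\<close>.
\<close>

fun mu_mult :: "('a \<times> 'a) option \<Rightarrow> ('a \<times> 'a) option \<Rightarrow> ('a \<times> 'a) option" where
  "mu_mult (Some (a, b)) (Some (c, d)) = (if b = c then Some (a, d) else None)"
| "mu_mult None _ = None"
| "mu_mult _ None = None"

text \<open>
  This is only a semigroup. The record type \<open>monoid\<close> has a field \<open>one\<close>, which is left
  unspecified here; none of \<^const>\<open>hom\<close>, \<^const>\<open>mon\<close>, \<^const>\<open>auto\<close>, \<^const>\<open>iso\<close> looks at it.
\<close>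

definition matrix_units :: "'a set \<Rightarrow> ('a \<times> 'a) option monoid" where
  "matrix_units L =
    \<lparr>carrier = insert None (Some ` (L \<times> L)), mult = mu_mult, one = undefined\<rparr>"

lemma matrix_units_closed:
  "\<lbrakk>x \<in> carrier (matrix_units L); y \<in> carrier (matrix_units L)\<rbrakk>
    \<Longrightarrow> x \<otimes>\<^bsub>matrix_units L\<^esub> y \<in> carrier (matrix_units L)"
  by (auto simp: matrix_units_def)

lemma matrix_units_assoc:
  "(x \<otimes>\<^bsub>matrix_units L\<^esub> y) \<otimes>\<^bsub>matrix_units L\<^esub> z =
    x \<otimes>\<^bsub>matrix_units L\<^esub> (y \<otimes>\<^bsub>matrix_units L\<^esub> z)"
  by (cases x; cases y; cases z) (auto simp: matrix_units_def)

text \<open>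
  A set \<open>F\<close> of self-maps of \<open>S\<close> under composition from left to right: the product of \<open>f\<close> and \<open>g\<close>
  applies \<open>f\<close> first. (The library's \<^const>\<open>BijGroup\<close> and \<^const>\<open>AutoGroup\<close> compose in the
  opposite order.) Self-maps of \<open>S\<close> are taken extensional, so that two of them are equal
  iff they agree on \<open>S\<close>.
\<close>

definition maps_monoid :: "'a set \<Rightarrow> ('a \<Rightarrow> 'a) set \<Rightarrow> ('a \<Rightarrow> 'a) monoid" where
  "maps_monoid S F = \<lparr>carrier = F, mult = (\<lambda>f g. compose S g f), one = (\<lambda>x\<in>S. x)\<rparr>"

definition inj_End :: "('a, 'b) monoid_scheme \<Rightarrow> ('a \<Rightarrow> 'a) monoid" where
  "inj_End G = maps_monoid (carrier G) (mon G G \<inter> extensional (carrier G))"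

definition inj_Transf :: "'a set \<Rightarrow> ('a \<Rightarrow> 'a) monoid" where
  "inj_Transf S = maps_monoid S {f \<in> S \<rightarrow>\<^sub>E S. inj_on f S}"

definition Aut :: "('a, 'b) monoid_scheme \<Rightarrow> ('a \<Rightarrow> 'a) monoid" where
  "Aut G = maps_monoid (carrier G) (auto G)"

definition Sym :: "'a set \<Rightarrow> ('a \<Rightarrow> 'a) monoid" where
  "Sym S = maps_monoid S (Bij S)"

lemma monoid_maps_monoid:
  assumes "F \<subseteq> S \<rightarrow>\<^sub>E S" "(\<lambda>x\<in>S. x) \<in> F" "\<And>f g. \<lbrakk>f \<in> F; g \<in> F\<rbrakk> \<Longrightarrow> compose S g f \<in> F"
  shows "monoid (maps_monoid S F)"
proof (rule monoidI)
  fix f g h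
  assume "f \<in> carrier (maps_monoid S F)" "g \<in> carrier (maps_monoid S F)"
    "h \<in> carrier (maps_monoid S F)"
  then have "f \<in> S \<rightarrow> S" using assms(1) by (auto simp: maps_monoid_def PiE_def)
  then show "f \<otimes>\<^bsub>maps_monoid S F\<^esub> g \<otimes>\<^bsub>maps_monoid S F\<^esub> h =
      f \<otimes>\<^bsub>maps_monoid S F\<^esub> (g \<otimes>\<^bsub>maps_monoid S F\<^esub> h)"
    by (simp add: maps_monoid_def compose_assoc)
next
  fix f assume "f \<in> carrier (maps_monoid S F)"
  then have f: "f \<in> S \<rightarrow> S" "f \<in> extensional S"
    using assms(1) by (auto simp: maps_monoid_def PiE_def)
  show "\<one>\<^bsub>maps_monoid S F\<^esub> \<otimes>\<^bsub>maps_monoid S F\<^esub> f = f"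
    "f \<otimes>\<^bsub>maps_monoid S F\<^esub> \<one>\<^bsub>maps_monoid S F\<^esub> = f"
    using f by (simp_all add: maps_monoid_def)
qed (use assms in \<open>simp_all add: maps_monoid_def\<close>)

lemma monoid_inj_Transf: "monoid (inj_Transf S)"
  unfolding inj_Transf_def
proof (rule monoid_maps_monoid)
  fix f g assume "f \<in> {f \<in> S \<rightarrow>\<^sub>E S. inj_on f S}" "g \<in> {f \<in> S \<rightarrow>\<^sub>E S. inj_on f S}"
  then have fg: "f \<in> S \<rightarrow>\<^sub>E S" "g \<in> S \<rightarrow>\<^sub>E S" "inj_on f S" "inj_on g S"
    by simp_all
  have "compose S g f \<in> S \<rightarrow>\<^sub>E S"
    using fg(1,2) by (auto simp: compose_def)
  moreover have "inj_on (compose S g f) S"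
  proof (rule inj_onI)
    fix x y assume xy: "x \<in> S" "y \<in> S" "compose S g f x = compose S g f y"
    then have "g (f x) = g (f y)" by (simp add: compose_def)
    then have "f x = f y" using fg(1,4) xy(1,2) by (metis PiE_mem inj_onD)
    then show "x = y" using fg(3) xy(1,2) by (metis inj_onD)
  qed
  ultimately show "compose S g f \<in> {f \<in> S \<rightarrow>\<^sub>E S. inj_on f S}" by simp
qed (auto simp: inj_on_def)

lemma compose_hom:
  assumes closed: "\<And>x y. \<lbrakk>x \<in> carrier G; y \<in> carrier G\<rbrakk> \<Longrightarrow> x \<otimes>\<^bsub>G\<^esub> y \<in> carrier G"
    and f: "f \<in> hom G G" and g: "g \<in> hom G G"
  shows "compose (carrier G) g f \<in> hom G G"
proof (rule homI)
  fix x y assume xy: "x \<in> carrier G" "y \<in> carrier G"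
  have mem: "f x \<in> carrier G" "f y \<in> carrier G"
    using f xy by (auto intro: hom_in_carrier)
  show "compose (carrier G) g f x \<in> carrier G"
    using g mem xy by (auto simp: compose_eq intro: hom_in_carrier)
  show "compose (carrier G) g f (x \<otimes>\<^bsub>G\<^esub> y) =
      compose (carrier G) g f x \<otimes>\<^bsub>G\<^esub> compose (carrier G) g f y"
    using mem xy by (simp add: compose_eq hom_mult[OF f] hom_mult[OF g] closed)
qed

lemma monoid_inj_End:
  assumes closed: "\<And>x y. \<lbrakk>x \<in> carrier G; y \<in> carrier G\<rbrakk> \<Longrightarrow> x \<otimes>\<^bsub>G\<^esub> y \<in> carrier G"
  shows "monoid (inj_End G)"
  unfolding inj_End_def
proof (rule monoid_maps_monoid)
  show "mon G G \<inter> extensional (carrier G) \<subseteq> carrier G \<rightarrow>\<^sub>E carrier G"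
    by (auto simp: mon_def PiE_def hom_def)
  show "(\<lambda>x\<in>carrier G. x) \<in> mon G G \<inter> extensional (carrier G)"
    by (simp add: mon_def hom_def inj_on_def closed)
  fix f g assume f: "f \<in> mon G G \<inter> extensional (carrier G)"
    and g: "g \<in> mon G G \<inter> extensional (carrier G)"
  have "compose (carrier G) g f \<in> hom G G"
    using f g by (auto simp: mon_def intro: compose_hom closed)
  moreover have "inj_on (compose (carrier G) g f) (carrier G)"
  proof (rule inj_onI)
    fix x y assume xy: "x \<in> carrier G" "y \<in> carrier G"
      "compose (carrier G) g f x = compose (carrier G) g f y"
    have mem: "f x \<in> carrier G" "f y \<in> carrier G"
      using f xy by (auto simp: mon_def intro: hom_in_carrier)
    have "g (f x) = g (f y)" using xy by (simp add: compose_eq)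
    then have "f x = f y" using g mem by (auto simp: mon_def dest: inj_onD)
    then show "x = y" using f xy(1,2) by (auto simp: mon_def dest: inj_onD)
  qed
  ultimately show "compose (carrier G) g f \<in> mon G G \<inter> extensional (carrier G)"
    by (simp add: mon_def)
qed

lemma group_Sym: "group (Sym S)"
proof -
  have "monoid (Sym S)"
    unfolding Sym_def
  proof (rule monoid_maps_monoid)
    show "Bij S \<subseteq> S \<rightarrow>\<^sub>E S"
      by (simp add: subset_iff PiE_def Bij_imp_funcset Bij_imp_extensional)
  qed (simp_all add: id_Bij compose_Bij)
  then interpret monoid "Sym S" .
  show ?thesis
  proof (rule group_l_invI)
    fix f assume "f \<in> carrier (Sym S)"
    then have f: "f \<in> Bij S" by (simp add: Sym_def maps_monoid_def)
    have "compose S f (restrict (inv_into S f) S) = (\<lambda>x\<in>S. x)"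
      using f by (intro compose_id_inv_into) (simp add: Bij_def bij_betw_def)
    then show "\<exists>g\<in>carrier (Sym S). g \<otimes>\<^bsub>Sym S\<^esub> f = \<one>\<^bsub>Sym S\<^esub>"
      using restrict_inv_into_Bij[OF f] by (auto simp: Sym_def maps_monoid_def)
  qed
qed

lemma group_Aut:
  assumes closed: "\<And>x y. \<lbrakk>x \<in> carrier G; y \<in> carrier G\<rbrakk> \<Longrightarrow> x \<otimes>\<^bsub>G\<^esub> y \<in> carrier G"
  shows "group (Aut G)"
proof -
  have "monoid (Aut G)"
    unfolding Aut_def
  proof (rule monoid_maps_monoid)
    show "auto G \<subseteq> carrier G \<rightarrow>\<^sub>E carrier G"
      by (auto simp: auto_def PiE_def Bij_imp_extensional hom_def)
    show "(\<lambda>x\<in>carrier G. x) \<in> auto G"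
      by (simp add: auto_def id_Bij hom_def closed)
    fix f g assume fg: "f \<in> auto G" "g \<in> auto G"
    have "compose (carrier G) g f \<in> hom G G"
      using fg by (auto simp: auto_def intro: compose_hom closed)
    then show "compose (carrier G) g f \<in> auto G"
      using fg by (simp add: auto_def compose_Bij)
  qed
  then interpret monoid "Aut G" .
  show ?thesis
  proof (rule group_l_invI)
    fix f assume "f \<in> carrier (Aut G)"
    then have f: "f \<in> hom G G" "f \<in> Bij (carrier G)"
      by (simp_all add: Aut_def maps_monoid_def auto_def)
    let ?g = "restrict (inv_into (carrier G) f) (carrier G)"
    have "?g \<in> hom G G"
    proof (rule homI)
      fix x y assume xy: "x \<in> carrier G" "y \<in> carrier G"
      then show "?g x \<in> carrier G" using f Bij_inv_into_mem by simp
      have "inv_into (carrier G) f (x \<otimes>\<^bsub>G\<^esub> y) =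
          inv_into (carrier G) f x \<otimes>\<^bsub>G\<^esub> inv_into (carrier G) f y"
        by (rule Bij_inv_into_lemma) (use f xy closed in \<open>auto simp: hom_def\<close>)
      then show "?g (x \<otimes>\<^bsub>G\<^esub> y) = ?g x \<otimes>\<^bsub>G\<^esub> ?g y" using xy closed by simp
    qed
    moreover have "compose (carrier G) f ?g = (\<lambda>x\<in>carrier G. x)"
      using f by (intro compose_id_inv_into) (simp add: Bij_def bij_betw_def)
    ultimately show "\<exists>g\<in>carrier (Aut G). g \<otimes>\<^bsub>Aut G\<^esub> f = \<one>\<^bsub>Aut G\<^esub>"
      using restrict_inv_into_Bij[OF f(2)] by (auto simp: Aut_def maps_monoid_def auto_def)
  qed
qed

end

theory Submission
  imports Defs
begin

text \<open>
  An injective endomorphism fixes zero: the image of zero absorbs every image on both sides, but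
  a matrix unit \<open>(p, q)\<close> absorbs only itself, and only if \<open>p = q\<close>. It thus sends
  nonzero idempotents to nonzero idempotents, so \<open>(a, a)\<close> goes to \<open>(g a, g a)\<close>, and
  \<open>(a, b) = (a, a) (a, b) (b, b)\<close> goes to \<open>(g a, g b)\<close>.
\<close>

definition mu_map :: "'a set \<Rightarrow> ('a \<Rightarrow> 'a) \<Rightarrow> ('a \<times> 'a) option \<Rightarrow> ('a \<times> 'a) option" where
  "mu_map L g = (\<lambda>x\<in>carrier (matrix_units L). map_option (map_prod g g) x)"

text \<open>For an injective endomorphism \<open>f\<close> of the matrix units, \<open>f\<close>
  sends \<open>(a, a)\<close> to a unit \<open>(c, c)\<close>, so \<open>the\<close> meets no zero
  and \<open>fst\<close> loses nothing.\<close>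

definition diag_map :: "'a set \<Rightarrow> (('a \<times> 'a) option \<Rightarrow> ('a \<times> 'a) option) \<Rightarrow> 'a \<Rightarrow> 'a" where
  "diag_map L f = (\<lambda>a\<in>L. fst (the (f (Some (a, a)))))"

lemma mem_matrix_units [simp]:
  "None \<in> carrier (matrix_units L)"
  "Some (a, b) \<in> carrier (matrix_units L) \<longleftrightarrow> a \<in> L \<and> b \<in> L"
  by (auto simp: matrix_units_def)

lemma mult_matrix_units [simp]: "x \<otimes>\<^bsub>matrix_units L\<^esub> y = mu_mult x y"
  by (simp add: matrix_units_def)

lemma matrix_units_cases [consumes 1, case_names zero unit]:
  assumes "x \<in> carrier (matrix_units L)"
  obtains "x = None" | a b where "x = Some (a, b)" "a \<in> L" "b \<in> L"
  using assms by (auto simp: matrix_units_def)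

lemma mu_map_simps [simp]:
  "mu_map L g None = None"
  "\<lbrakk>a \<in> L; b \<in> L\<rbrakk> \<Longrightarrow> mu_map L g (Some (a, b)) = Some (g a, g b)"
  by (simp_all add: mu_map_def)

text \<open>Injectivity of \<open>g\<close> is what preserves zero products:
  \<open>b \<noteq> c\<close> must force \<open>g b \<noteq> g c\<close>, lest a zero product
  acquire a nonzero image.\<close>

lemma mu_map_mon:
  assumes "g \<in> L \<rightarrow> L" "inj_on g L"
  shows "mu_map L g \<in> mon (matrix_units L) (matrix_units L)"
proof -
  have "mu_map L g \<in> hom (matrix_units L) (matrix_units L)"
  proof (rule homI)
    fix x assume "x \<in> carrier (matrix_units L)"
    then show "mu_map L g x \<in> carrier (matrix_units L)"
      using assms(1) by (cases rule: matrix_units_cases) auto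
  next
    fix x y assume xy: "x \<in> carrier (matrix_units L)" "y \<in> carrier (matrix_units L)"
    show "mu_map L g (x \<otimes>\<^bsub>matrix_units L\<^esub> y) =
        mu_map L g x \<otimes>\<^bsub>matrix_units L\<^esub> mu_map L g y"
      using xy(1)
    proof (cases rule: matrix_units_cases)
      case (unit a b)
      with xy(2) assms(2) show ?thesis
        by (cases rule: matrix_units_cases) (auto dest: inj_onD)
    qed simp
  qed
  moreover have "inj_on (mu_map L g) (carrier (matrix_units L))"
    using assms(2) by (auto simp: inj_on_def matrix_units_def)
  ultimately show ?thesis by (simp add: mon_def)
qed

lemma diag_map_mu_map:
  assumes "g \<in> extensional L"
  shows "diag_map L (mu_map L g) = g"
  using assms by (auto simp: diag_map_def extensional_def)

lemma mon_matrix_units_None: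
  assumes "L \<noteq> {}" and f: "f \<in> mon (matrix_units L) (matrix_units L)"
  shows "f None = None"
proof (rule ccontr)
  assume "f None \<noteq> None"
  from f have hom: "f \<in> hom (matrix_units L) (matrix_units L)"
    and inj: "inj_on f (carrier (matrix_units L))"
    by (simp_all add: mon_def)
  obtain p q where pq: "f None = Some (p, q)"
    using \<open>f None \<noteq> None\<close> by auto
  obtain a where a: "a \<in> L" using assms(1) by blast
  have l: "mu_mult (f None) (f (Some (a, a))) = f None"
    using hom_mult[OF hom, of None "Some (a, a)"] a by simp
  have r: "mu_mult (f (Some (a, a))) (f None) = f None"
    using hom_mult[OF hom, of "Some (a, a)" None] a by simp
  \<comment> \<open>By \<open>l\<close> and \<open>r\<close> the image of \<open>(a, a)\<close> is
    nonzero, say \<open>(c, d)\<close>. Then \<open>l\<close> gives \<open>c = d = q\<close> and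
    \<open>r\<close> gives \<open>c = d = p\<close>.\<close>
  have "f (Some (a, a)) = f None"
    using l r by (cases "f (Some (a, a))") (auto simp: pq split: if_splits)
  then show False using inj_onD[OF inj, of "Some (a, a)" None] a by simp
qed

lemma mon_matrix_units_eq:
  assumes "L \<noteq> {}" and f: "f \<in> mon (matrix_units L) (matrix_units L)" and "a \<in> L" "b \<in> L"
  shows "f (Some (a, b)) = Some (diag_map L f a, diag_map L f b)"
proof -
  from f have hom: "f \<in> hom (matrix_units L) (matrix_units L)"
    and inj: "inj_on f (carrier (matrix_units L))"
    by (simp_all add: mon_def)
  have nonzero: "f (Some (c, d)) \<noteq> None" if "c \<in> L" "d \<in> L" for c d
  proof
    assume "f (Some (c, d)) = None"
    with inj_onD[OF inj, of "Some (c, d)" None] that show False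
      by (simp add: mon_matrix_units_None[OF assms(1) f])
  qed
  have diag: "f (Some (c, c)) = Some (diag_map L f c, diag_map L f c)" if c: "c \<in> L" for c
  proof -
    obtain p q where "f (Some (c, c)) = Some (p, q)"
      using nonzero[OF c c] by auto
    \<comment> \<open>The square of \<open>(p, q)\<close> is again \<open>(p, q)\<close>, hence
      nonzero, which forces \<open>p = q\<close>.\<close>
    then show ?thesis
      using hom_mult[OF hom, of "Some (c, c)" "Some (c, c)"] c
      by (auto simp: diag_map_def split: if_splits)
  qed
  obtain p q where pq: "f (Some (a, b)) = Some (p, q)"
    using nonzero[OF assms(3,4)] by auto
  \<comment> \<open>The left factor is a diagonal unit, and its product with \<open>(p, q)\<close>
    is nonzero only if the indices match; this reads off the first coordinate. Multiplying by
    \<open>(b, b)\<close> on the right reads off the second.\<close>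
  have "mu_mult (f (Some (a, a))) (f (Some (a, b))) = f (Some (a, b))"
    using hom_mult[OF hom, of "Some (a, a)" "Some (a, b)"] assms(3,4) by simp
  then have "diag_map L f a = p"
    unfolding pq diag[OF assms(3)] by (simp split: if_splits)
  moreover have "mu_mult (f (Some (a, b))) (f (Some (b, b))) = f (Some (a, b))"
    using hom_mult[OF hom, of "Some (a, b)" "Some (b, b)"] assms(3,4) by simp
  then have "diag_map L f b = q"
    unfolding pq diag[OF assms(4)] by (simp split: if_splits)
  ultimately show ?thesis
    by (simp add: pq)
qed

lemma mu_map_diag_map:
  assumes "L \<noteq> {}" "f \<in> mon (matrix_units L) (matrix_units L)"
    "f \<in> extensional (carrier (matrix_units L))"
  shows "mu_map L (diag_map L f) = f"
proof (rule extensionalityI)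
  show "mu_map L (diag_map L f) \<in> extensional (carrier (matrix_units L))"
    by (simp add: mu_map_def)
  fix x assume "x \<in> carrier (matrix_units L)"
  then show "mu_map L (diag_map L f) x = f x"
    by (cases rule: matrix_units_cases)
      (simp_all add: mon_matrix_units_None[OF assms(1,2)] mon_matrix_units_eq[OF assms(1,2)])
qed (fact assms(3))

lemma diag_map_inj_Transf:
  assumes "L \<noteq> {}" and f: "f \<in> mon (matrix_units L) (matrix_units L)"
  shows "diag_map L f \<in> L \<rightarrow>\<^sub>E L" "inj_on (diag_map L f) L"
proof -
  have "f (Some (a, a)) \<in> carrier (matrix_units L)" if "a \<in> L" for a
    using f that by (auto simp: mon_def intro: hom_in_carrier)
  then show "diag_map L f \<in> L \<rightarrow>\<^sub>E L"
    by (auto simp: mon_matrix_units_eq[OF assms]) (simp add: diag_map_def)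
  have inj: "inj_on f (carrier (matrix_units L))"
    using f by (simp add: mon_def)
  show "inj_on (diag_map L f) L"
  proof (rule inj_onI)
    fix a b assume "a \<in> L" "b \<in> L" "diag_map L f a = diag_map L f b"
    then show "a = b"
      using inj_onD[OF inj, of "Some (a, a)" "Some (b, b)"]
      by (simp add: mon_matrix_units_eq[OF assms])
  qed
qed

text \<open>Diagonal units go to diagonal units, so following \<open>(a, a)\<close> through
  \<open>f\<close> and then \<open>g\<close> suffices. The order of composition is kept, so the
  correspondence is an isomorphism and not an anti-isomorphism.\<close>

lemma diag_map_compose:
  assumes "L \<noteq> {}"
    and f: "f \<in> mon (matrix_units L) (matrix_units L)"
    and g: "g \<in> mon (matrix_units L) (matrix_units L)"
  shows "diag_map L (compose (carrier (matrix_units L)) g f) =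
    compose L (diag_map L g) (diag_map L f)"
proof (rule extensionalityI)
  fix a assume a: "a \<in> L"
  then have "diag_map L f a \<in> L" using diag_map_inj_Transf(1)[OF assms(1) f] by auto
  then have "compose (carrier (matrix_units L)) g f (Some (a, a)) =
      Some (diag_map L g (diag_map L f a), diag_map L g (diag_map L f a))"
    using a by (simp add: compose_eq mon_matrix_units_eq[OF assms(1)] f g)
  then show "diag_map L (compose (carrier (matrix_units L)) g f) a =
      compose L (diag_map L g) (diag_map L f) a"
    using a by (simp add: compose_eq diag_map_def[of L "compose _ _ _"])
qed (simp_all add: diag_map_def)

lemma surj_diag_map_iff:
  assumes "L \<noteq> {}" and f: "f \<in> mon (matrix_units L) (matrix_units L)"
  shows "diag_map L f ` L = L \<longleftrightarrow> f ` carrier (matrix_units L) = carrier (matrix_units L)"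
proof -
  have "f ` carrier (matrix_units L) =
      insert None (Some ` (diag_map L f ` L \<times> diag_map L f ` L))"
  proof -
    have "f ` Some ` (L \<times> L) = Some ` map_prod (diag_map L f) (diag_map L f) ` (L \<times> L)"
      unfolding image_image
      by (rule image_cong) (auto simp: mon_matrix_units_eq[OF assms])
    then show ?thesis
      by (simp add: matrix_units_def mon_matrix_units_None[OF assms] map_prod_surj_on[OF refl refl])
  qed
  also have "\<dots> = carrier (matrix_units L) \<longleftrightarrow> diag_map L f ` L = L"
    using insert_ident[of None "Some ` (diag_map L f ` L \<times> diag_map L f ` L)" "Some ` (L \<times> L)"]
    by (auto simp: matrix_units_def inj_image_eq_iff times_eq_iff)
  finally show ?thesis by simp
qed

text \<open>Here and in \<open>Bij_eq_inj\<close> the bijective maps are cut out of the injective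
  ones by surjectivity, the form in which \<open>bij_betw_Collect\<close> applies.\<close>

lemma auto_eq_mon:
  "auto G = {f \<in> mon G G \<inter> extensional (carrier G). f ` carrier G = carrier G}"
  by (auto simp: auto_def mon_def Bij_def bij_betw_def)

lemma Bij_eq_inj: "Bij S = {f \<in> {f \<in> S \<rightarrow>\<^sub>E S. inj_on f S}. f ` S = S}"
  by (auto simp: Bij_def bij_betw_def PiE_def)

lemma iso_maps_monoidI:
  assumes "bij_betw \<phi> F K"
    and "\<And>f g. \<lbrakk>f \<in> F; g \<in> F\<rbrakk> \<Longrightarrow> \<phi> (compose S g f) = compose T (\<phi> g) (\<phi> f)"
  shows "maps_monoid S F \<cong> maps_monoid T K"
proof -
  have "\<phi> \<in> iso (maps_monoid S F) (maps_monoid T K)"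
    using assms bij_betwE[OF assms(1)] by (auto simp: iso_def hom_def maps_monoid_def)
  then show ?thesis by (auto simp: is_iso_def)
qed

text \<open>The inverse is \<open>mu_map L\<close>. Extensionality makes both composites equal to
  the identity as functions, since agreement on the carrier or on \<open>L\<close> then means
  equality.\<close>

lemma bij_betw_diag_map:
  assumes "L \<noteq> {}"
  shows "bij_betw (diag_map L)
    (mon (matrix_units L) (matrix_units L) \<inter> extensional (carrier (matrix_units L)))
    {g \<in> L \<rightarrow>\<^sub>E L. inj_on g L}"
proof (rule bij_betw_byWitness[where f' = "mu_map L"])
  show "mu_map L ` {g \<in> L \<rightarrow>\<^sub>E L. inj_on g L} \<subseteq>
      mon (matrix_units L) (matrix_units L) \<inter> extensional (carrier (matrix_units L))"
    by (auto simp: PiE_def intro!: mu_map_mon) (simp add: mu_map_def)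
qed (use diag_map_inj_Transf[OF assms] in
      \<open>auto simp: mu_map_diag_map[OF assms] diag_map_mu_map PiE_def\<close>)

theorem theorem3:
  fixes L :: "'a set"
  assumes "L \<noteq> {}"
  shows "inj_End (matrix_units L) \<cong> inj_Transf L \<and> Aut (matrix_units L) \<cong> Sym L"
proof
  show "inj_End (matrix_units L) \<cong> inj_Transf L"
    unfolding inj_End_def inj_Transf_def
    by (rule iso_maps_monoidI[OF bij_betw_diag_map[OF assms]])
      (simp add: diag_map_compose[OF assms])
  show "Aut (matrix_units L) \<cong> Sym L"
    unfolding Aut_def Sym_def auto_eq_mon Bij_eq_inj
    \<comment> \<open>The bijection between injective maps restricts to the surjective ones on both
      sides, because \<open>surj_diag_map_iff\<close> matches the two surjectivity
      conditions.\<close>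
    by (rule iso_maps_monoidI[OF bij_betw_Collect[OF bij_betw_diag_map[OF assms]]])
      (simp_all add: diag_map_compose[OF assms] surj_diag_map_iff[OF assms])
qed

end
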